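(* Let $d\ge1$ be an integer, let $K\colon\mathbb{R}^d\times\mathbb{R}^d\to\mathbb{R}$ and $\mathrm{k}\colon\mathbb{R}\times\mathbb{R}\to\mathbb{R}$ be related by $$K(x,y)=\mathbb{E}_{\xi\sim\mathcal{U}_{\mathbb{S}^{d-1}}}\big[\mathrm{k}(P_\xi(x),P_\xi(y))\big]\qquad\text{for all }x,y\in\mathbb{R}^d,$$ let $P\ge 1$, and let $\xi_1,\dots,\xi_P\sim\mathcal{U}_{\mathbb{S}^{d-1}}$ be i.i.d. (i) Assume that $|\mathrm{k}(s,t)|\le C$ for all $s,t\in\mathbb{R}$, for some $C$ independent of $d$. Then for all $x,y\in\mathbb{R}^d$ $$\mathbb{E}\Big[\Big|\frac1P\sum_{p=1}^P\mathrm{k}(P_{\xi_p}(x),P_{\xi_p}(y))-K(x,y)\Big|\Big]\le\frac{\sqrt{2\pi}\,C}{\sqrt{P}}\in O\Big(\frac{1}{\sqrt P}\Big),$$ with the $O$-constant independent of $d$. Moreover, for every $\sigma>0$ this assumption is fulfilled with $C=1$ for the Gaussian kernel $K(x,y)=\exp\big(-\tfrac{\|x-y\|^2}{2\sigma^2}\big)$ and its one-dimensional counterpart $\mathrm{k}(s,t)={_1}F_1\big(\tfrac d2;\tfrac12;\tfrac{-|s-t|^2}{2\sigma^2}\big)$. (ii) Let $K(x,y)=-\|x-y\|$ and let $\mathrm{k}(s,t)=-\frac{\sqrt{\pi}\,\Gamma(\frac{d+1}{2})}{\Gamma(\frac d2)}|s-t|$ be its one-dimensional counterpart. Then for all $x,y\in\mathbb{R}^d$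 $$\mathbb{E}\Big[\Big|\frac1P\sum_{p=1}^P\mathrm{k}(P_{\xi_p}(x),P_{\xi_p}(y))-K(x,y)\Big|\Big]\le\frac{\sqrt{8}\,\pi\,\Gamma(\frac{d+1}{2})\,\|x-y\|}{\Gamma(\frac d2)\sqrt{P}}\in O\Big(\frac{\sqrt d\,\|x-y\|}{\sqrt P}\Big),$$ with an absolute $O$-constant.
   Context: $\|\cdot\|$ is the Euclidean norm, $\mathbb{S}^{d-1}$ the unit sphere in $\mathbb{R}^d$, $\mathcal{U}_{\mathbb{S}^{d-1}}$ the uniform probability distribution on it, and $P_\xi(x)=\langle\xi,x\rangle$ for $\xi\in\mathbb{S}^{d-1}$, $x\in\mathbb{R}^d$. The kernel $\mathrm{k}$ is measurable and such that the expectation defining $K$ exists. "One-dimensional counterpart" of $K$ means a kernel $\mathrm{k}$ on $\mathbb{R}$ satisfying the displayed relation between $K$ and $\mathrm{k}$. ${_1}F_1$ is the confluent hypergeometric function ${_1}F_1(a;b;z)=\sum_{n=0}^\infty\frac{\Gamma(a+n)\Gamma(b)}{\Gamma(a)\Gamma(b+n)}\frac{z^n}{n!}$. *)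

theory Defs
  imports "HOL-Probability.Probability"
begin

text \<open>
  The uniform distribution on the unit sphere, as the image of the uniform distribution on the
  closed unit ball under radial projection \<^term>\<open>\<lambda>x. x /\<^sub>R norm x\<close> (that is, normalised cone
  measure, which coincides with normalised surface measure).  It is a Borel measure on the whole
  space, concentrated on the sphere; in dimension 1 it gives mass 1/2 to each of 1 and -1.
\<close>

definition sphere_uniform :: "'a::euclidean_space measure" where
  "sphere_uniform = distr (uniform_measure lborel (cball 0 1)) borel sgn"

lemma emeasure_unit_cball:
  "emeasure lborel (cball (0::'a::euclidean_space) 1) \<noteq> 0"
  "emeasure lborel (cball (0::'a::euclidean_space) 1) \<noteq> \<infinity>"
  by (auto simp: emeasure_cball ennreal_eq_0_iff not_le)

lemma prob_space_sphere_uniform: "prob_space (sphere_uniform :: 'a::euclidean_space measure)"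
proof -
  interpret prob_space "uniform_measure lborel (cball (0::'a) 1)"
    using emeasure_unit_cball[where 'a='a] by (intro prob_space_uniform_measure) auto
  show ?thesis
    unfolding sphere_uniform_def by (rule prob_space_distr) simp
qed

lemma AE_sphere_uniform: "AE \<xi> in (sphere_uniform :: 'a::euclidean_space measure). \<xi> \<in> sphere 0 1"
proof -
  have "AE x in lborel. x \<noteq> (0::'a)"
    by (rule AE_lborel_singleton)
  then have "AE x in uniform_measure lborel (cball (0::'a) 1). sgn x \<in> sphere 0 1"
    by (intro AE_uniform_measureI) (auto simp: norm_sgn)
  then show ?thesis
    unfolding sphere_uniform_def by (subst AE_distr_iff) auto
qed

text \<open>
  Integrability is required explicitly because the Bochner integral of a non-integrable function
  is 0.
\<close>

definition one_dim_counterpart ::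
    "('a::euclidean_space \<Rightarrow> 'a \<Rightarrow> real) \<Rightarrow> (real \<Rightarrow> real \<Rightarrow> real) \<Rightarrow> bool" where
  "one_dim_counterpart K k \<longleftrightarrow>
     (\<lambda>(s, t). k s t) \<in> borel_measurable (borel \<Otimes>\<^sub>M borel) \<and>
     (\<forall>x y. integrable sphere_uniform (\<lambda>\<xi>. k (\<xi> \<bullet> x) (\<xi> \<bullet> y)) \<and>
            K x y = (LINT \<xi>|sphere_uniform. k (\<xi> \<bullet> x) (\<xi> \<bullet> y)))"

definition sliced_estimator ::
    "(real \<Rightarrow> real \<Rightarrow> real) \<Rightarrow> nat \<Rightarrow> (nat \<Rightarrow> 'a::euclidean_space) \<Rightarrow> 'a \<Rightarrow> 'a \<Rightarrow> real" where
  "sliced_estimator k P \<xi> x y = 1 / real P * (\<Sum>p = 1..P. k (\<xi> p \<bullet> x) (\<xi> p \<bullet> y))"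

definition hyp_1F1 :: "real \<Rightarrow> real \<Rightarrow> real \<Rightarrow> real" where
  "hyp_1F1 a b z =
     (\<Sum>n. Gamma (a + real n) * Gamma b / (Gamma a * Gamma (b + real n)) * (z ^ n / fact n))"

end

theory Submission
  imports Defs
begin

text \<open>
  A standard Gaussian vector \<open>X\<close> has independent direction and length, its direction being uniform on
  the sphere.  Hence for a one-dimensional function \<open>g\<close>, averaging \<open>g (r * (\<xi> \<bullet> z))\<close> over
  the direction \<open>\<xi>\<close> and over the law of \<open>r = norm X\<close> gives the mean of \<open>g (X \<bullet> z)\<close>, where
  \<open>X \<bullet> z\<close> is a centred normal variable with standard deviation \<open>norm z\<close>.  With \<open>g = cos\<close> the
  average over \<open>r\<close> is the confluent hypergeometric function, by termwise integration of the cosine series;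
  this both identifies the counterpart of the Gaussian kernel and shows that it is bounded by 1.
  With \<open>g\<close> the absolute value one obtains the counterpart of the negative distance kernel.
  The error bounds come from comparing the mean absolute deviation with the standard deviation.
\<close>

subsection \<open>Polar coordinates\<close>

lemma emeasure_lborel_vimage_scaleR:
  fixes S :: "'a::euclidean_space set"
  assumes "S \<in> sets borel" "c > 0"
  shows "emeasure lborel S = ennreal (c ^ DIM('a)) * emeasure lborel ((\<lambda>x. c *\<^sub>R x) -` S)"
proof -
  have "emeasure lborel S = emeasure (density (distr lborel borel (\<lambda>x::'a. 0 + c *\<^sub>R x)) (\<lambda>_. ennreal (\<bar>c\<bar> ^ DIM('a)))) S"
    using assms(2) by (subst lborel_affine[of c 0]) auto
  also have "\<dots> = ennreal (c ^ DIM('a)) * emeasure lborel ((\<lambda>x. c *\<^sub>R x) -` S)"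
    using assms by (simp add: emeasure_density_const emeasure_distr)
  finally show ?thesis .
qed

lemma vimage_sgn_borel [measurable]:
  "A \<in> sets borel \<Longrightarrow> sgn -` A \<in> sets (borel :: 'a::euclidean_space measure)"
  by (rule measurable_sets_borel[of sgn borel]) simp_all

lemma emeasure_sphere_uniform:
  assumes "A \<in> sets (borel :: 'a::euclidean_space measure)"
  shows "emeasure sphere_uniform A =
    emeasure lborel (cball 0 1 \<inter> sgn -` A) / emeasure lborel (cball (0::'a) 1)"
  using assms unfolding sphere_uniform_def
  by (subst emeasure_distr) (simp_all add: vimage_sgn_borel)

text \<open>Dilation by \<open>r > 0\<close> does not change \<open>sgn\<close>, so it maps the cone
  over \<open>A\<close> inside the unit ball onto the cone inside the ball of radius
  \<open>r\<close>. Both volumes scale by the same power of \<open>r\<close>, and for radius 1 the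
  identity is the definition of \<open>sphere_uniform\<close>. For \<open>r \<le> 0\<close> both
  sides vanish.\<close>

lemma emeasure_cone_cball:
  fixes A :: "'a::euclidean_space set"
  assumes [measurable]: "A \<in> sets borel"
  shows "emeasure lborel (cball 0 r \<inter> sgn -` A) = emeasure sphere_uniform A * emeasure lborel (cball (0::'a) r)"
proof -
  consider "r < 0" | "r = 0" | "r > 0" by linarith
  then show ?thesis
  proof cases
    case 2
    have "emeasure lborel ({0} \<inter> sgn -` A) \<le> emeasure lborel {0::'a}"
      by (intro emeasure_mono) auto
    with 2 show ?thesis by auto
  next
    case 3
    have sgn: "sgn (r *\<^sub>R x) = sgn x" for x :: 'a
      using 3 by (simp add: sgn_div_norm)
    have [measurable]: "cball 0 r \<inter> sgn -` A \<in> sets borel"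
      by (intro sets.Int) simp_all
    have "(\<lambda>x. r *\<^sub>R x) -` (cball 0 r \<inter> sgn -` A) = cball 0 1 \<inter> sgn -` A"
      "(\<lambda>x. r *\<^sub>R x) -` (cball 0 r) = (cball 0 1 :: 'a set)"
      using 3 by (auto simp: sgn)
    then have "emeasure lborel (cball 0 r \<inter> sgn -` A) = ennreal (r ^ DIM('a)) * emeasure lborel (cball 0 1 \<inter> sgn -` A)"
      and "emeasure lborel (cball (0::'a) r) = ennreal (r ^ DIM('a)) * emeasure lborel (cball (0::'a) 1)"
      using 3 by (simp_all add: emeasure_lborel_vimage_scaleR[where c=r])
    moreover have "emeasure lborel (cball 0 1 \<inter> sgn -` A) = emeasure sphere_uniform A * emeasure lborel (cball (0::'a) 1)"
      using emeasure_unit_cball[where 'a='a]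
      by (simp add: emeasure_sphere_uniform ennreal_divide_times less_top)
    ultimately show ?thesis by (simp add: mult_ac)
  qed simp
qed

text \<open>Half-lines form an intersection-stable generator of the Borel sets. Finiteness is asked
  only on half-lines because the image of Lebesgue measure under \<open>norm\<close> has infinite
  total mass.\<close>

lemma borel_measure_eqI_atMost:
  fixes M N :: "real measure"
  assumes "sets M = sets borel" "sets N = sets borel"
    and eq: "\<And>r. emeasure M {..r} = emeasure N {..r}" and fin: "\<And>r. emeasure M {..r} \<noteq> \<infinity>"
  shows "M = N"
proof (rule measure_eqI_generator_eq[where E="range atMost" and \<Omega>=UNIV and A="\<lambda>n. {..real n}"])
  show "Int_stable (range (atMost :: real \<Rightarrow> _))"
    by (auto simp: Int_stable_def)
  show "sets M = sigma_sets UNIV (range atMost)" "sets N = sigma_sets UNIV (range atMost)"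
    using assms(1,2) by (simp_all add: borel_eq_atMost)
  show "(\<Union>i. {..real i}) = UNIV"
    by (auto simp: real_arch_simple)
qed (use eq fin in auto)

text \<open>Polar coordinates with the angular variable tested only against indicators, which is
  enough for independence. Both sides integrate \<open>h\<close> against image measures under
  \<open>norm\<close>; the preimage of a half-line is a ball, so the measures agree by
  \<open>emeasure_cone_cball\<close>.\<close>

lemma nn_integral_polar:
  fixes A :: "'a::euclidean_space set"
  assumes [measurable]: "A \<in> sets borel" "h \<in> borel_measurable borel"
  shows "(\<integral>\<^sup>+x. indicator A (sgn x) * h (norm x) \<partial>lborel) =
    emeasure sphere_uniform A * (\<integral>\<^sup>+x. h (norm (x::'a)) \<partial>lborel)"
proof -
  have *: "norm -` {..r} = cball (0::'a) r" for r
    by auto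
  interpret S: prob_space "sphere_uniform :: 'a measure"
    by (rule prob_space_sphere_uniform)
  have "distr (density lborel (\<lambda>x::'a. indicator A (sgn x))) borel norm =
      density (distr (lborel :: 'a measure) borel norm) (\<lambda>_. emeasure sphere_uniform A)" (is "?M = ?N")
  proof (rule borel_measure_eqI_atMost)
    fix r
    have "emeasure ?M {..r} = (\<integral>\<^sup>+x. indicator A (sgn x) * indicator (cball 0 r) (x::'a) \<partial>lborel)"
      by (simp add: emeasure_distr emeasure_density * del: indicator_simps)
    also have "\<dots> = (\<integral>\<^sup>+x. indicator (cball 0 r \<inter> sgn -` A) (x::'a) \<partial>lborel)"
      by (intro nn_integral_cong) (simp split: split_indicator)
    also have "\<dots> = emeasure lborel (cball 0 r \<inter> sgn -` A)"
      by (intro nn_integral_indicator) simp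
    finally have M: "emeasure ?M {..r} = emeasure lborel (cball 0 r \<inter> sgn -` A)" .
    then show "emeasure ?M {..r} = emeasure ?N {..r}"
      by (simp add: emeasure_distr emeasure_density_const emeasure_cone_cball *)
    show "emeasure ?M {..r} \<noteq> \<infinity>"
      unfolding M emeasure_cone_cball[OF assms(1)]
      using emeasure_lborel_cball_finite[of "0::'a" r] by (auto simp: ennreal_mult_eq_top_iff)
  qed simp_all
  then have "integral\<^sup>N ?M h = integral\<^sup>N ?N h"
    by simp
  then show ?thesis
    by (simp add: nn_integral_distr nn_integral_density nn_integral_cmult)
qed

text \<open>The ball of radius \<open>r\<close> has volume \<open>v * r ^ DIM('a)\<close>, and the
  derivative of this function is the density of the image of Lebesgue measure under
  \<open>norm\<close>.\<close>

lemma nn_integral_radial: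
  assumes [measurable]: "h \<in> borel_measurable borel"
  shows "(\<integral>\<^sup>+x. h (norm (x::'a::euclidean_space)) \<partial>lborel) =
    emeasure lborel (cball (0::'a) 1) * of_nat DIM('a) *
      (\<integral>\<^sup>+r. ennreal (indicator {0..} r * r ^ (DIM('a) - 1)) * h r \<partial>lborel)"
proof -
  define v where "v = unit_ball_vol (DIM('a))"
  have v: "v > 0" unfolding v_def by simp
  let ?f = "\<lambda>r. ennreal (indicator {0..} r * (v * real DIM('a) * r ^ (DIM('a) - 1)))"
  have "distr (lborel :: 'a measure) borel norm = density lborel ?f" (is "?M = ?N")
  proof (rule borel_measure_eqI_atMost)
    fix r :: real
    have *: "norm -` {..r} = cball (0::'a) r"
      by auto
    have M: "emeasure ?M {..r} = emeasure lborel (cball (0::'a) r)"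
      by (simp add: emeasure_distr *)
    show "emeasure ?M {..r} \<noteq> \<infinity>"
      unfolding M using emeasure_lborel_cball_finite[of "0::'a" r] by simp
    show "emeasure ?M {..r} = emeasure ?N {..r}"
    proof (cases "r \<ge> 0")
      case True
      \<comment> \<open>The indicator of the nonnegative reals cuts the half-line down to a compact
        interval, where the fundamental theorem of calculus recovers the volume of the ball.\<close>
      have "emeasure ?N {..r} = (\<integral>\<^sup>+x. ennreal (v * real DIM('a) * x ^ (DIM('a) - 1)) * indicator {0..r} x \<partial>lborel)"
        by (simp add: emeasure_density) (auto intro!: nn_integral_cong simp: indicator_def)
      also have "\<dots> = ennreal (v * r ^ DIM('a) - v * 0 ^ DIM('a))"
        using True v by (intro nn_integral_FTC_Icc) (auto intro!: derivative_eq_intros)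
      finally show ?thesis
        unfolding M using True by (simp add: emeasure_cball v_def)
    next
      case False
      have "emeasure ?N {..r} = (\<integral>\<^sup>+x. 0 \<partial>(lborel :: real measure))"
        using False
        by (subst emeasure_density, simp, simp, intro nn_integral_cong) (auto simp: indicator_def)
      then show ?thesis
        unfolding M using False by simp
    qed
  qed simp_all
  then have "integral\<^sup>N ?M h = integral\<^sup>N ?N h"
    by simp
  also have "\<dots> = (\<integral>\<^sup>+r. ennreal (v * real DIM('a)) * (ennreal (indicator {0..} r * r ^ (DIM('a) - 1)) * h r) \<partial>lborel)"
    using v by (subst nn_integral_density)
      (auto intro!: nn_integral_cong simp: mult.assoc[symmetric] ennreal_mult'[symmetric] indicator_def)
  also have "\<dots> = ennreal (v * real DIM('a)) * (\<integral>\<^sup>+r. (ennreal (indicator {0..} r * r ^ (DIM('a) - 1)) * h r) \<partial>lborel)"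
    by (rule nn_integral_cmult) simp
  finally show ?thesis
    using v by (simp add: nn_integral_distr emeasure_cball v_def ennreal_mult ennreal_of_nat_eq_real_of_nat)
qed

subsection \<open>The standard Gaussian measure\<close>

text \<open>The product form of the density lets integrals factor over coordinates; the radial form
  in \<open>std_gaussian_altdef\<close> serves polar coordinates.\<close>

definition std_gaussian :: "'a::euclidean_space measure" where
  "std_gaussian = density lborel (\<lambda>x. ennreal (\<Prod>b\<in>Basis. std_normal_density (x \<bullet> b)))"

lemma sets_std_gaussian [simp, measurable_cong]: "sets std_gaussian = sets borel"
  and space_std_gaussian [simp]: "space std_gaussian = UNIV"
  by (simp_all add: std_gaussian_def)

lemma prod_exp_neg_half_inner_power2:
  "(\<Prod>b\<in>Basis. exp (- (x \<bullet> b)\<^sup>2 / 2)) = exp (- (norm (x::'a::euclidean_space))\<^sup>2 / 2)"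
proof -
  have "(\<Prod>b\<in>Basis. exp (- (x \<bullet> b)\<^sup>2 / 2)) = exp (\<Sum>b\<in>Basis. - (x \<bullet> b)\<^sup>2 / 2)"
    by (simp add: exp_sum)
  also have "(\<Sum>b\<in>Basis. - (x \<bullet> b)\<^sup>2 / 2) = - (norm x)\<^sup>2 / 2"
    unfolding power2_norm_eq_inner
    by (subst euclidean_inner) (simp add: power2_eq_square sum_negf sum_divide_distrib)
  finally show ?thesis .
qed

lemma prod_std_normal_density:
  "(\<Prod>b\<in>Basis. std_normal_density (x \<bullet> b)) =
    (1 / sqrt (2 * pi)) ^ DIM('a) * exp (- (norm (x::'a::euclidean_space))\<^sup>2 / 2)"
  using prod_exp_neg_half_inner_power2[of x]
  by (simp add: std_normal_density_def prod.distrib power_one_over prod_dividef)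

lemma std_gaussian_altdef:
  "std_gaussian = density lborel
    (\<lambda>x::'a::euclidean_space. ennreal ((1 / sqrt (2 * pi)) ^ DIM('a) * exp (- (norm x)\<^sup>2 / 2)))"
  unfolding std_gaussian_def prod_std_normal_density ..

lemma prob_space_std_gaussian: "prob_space (std_gaussian :: 'a::euclidean_space measure)"
proof
  have 1: "(\<integral>\<^sup>+x. ennreal (std_normal_density x) \<partial>lborel) = 1"
    using prob_space_normal_density[of 1 0, THEN prob_space.emeasure_space_1]
    by (simp add: emeasure_density)
  have "emeasure (std_gaussian :: 'a measure) (space std_gaussian) =
      (\<integral>\<^sup>+x. (\<Prod>b\<in>Basis. ennreal (std_normal_density (x \<bullet> b))) \<partial>(lborel :: 'a measure))"
    by (simp add: std_gaussian_def emeasure_density prod_ennreal)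
  also have "\<dots> = 1"
    by (subst nn_integral_lborel_prod) (simp_all add: 1)
  finally show "emeasure (std_gaussian :: 'a measure) (space std_gaussian) = 1" .
qed

text \<open>Lebesgue measure is the image of the product of its one-dimensional copies, so this is
  Fubini for a product of functions of single coordinates. Complex factors are allowed, for use with
  characteristic functions.\<close>

lemma integral_lborel_prod:
  fixes f :: "'a::euclidean_space \<Rightarrow> real \<Rightarrow> 'b::{real_normed_field, banach, second_countable_topology}"
  assumes "\<And>b. b \<in> Basis \<Longrightarrow> integrable lborel (f b)"
  shows "(\<integral>x. (\<Prod>b\<in>Basis. f b (x \<bullet> b)) \<partial>lborel) = (\<Prod>b\<in>Basis. integral\<^sup>L lborel (f b))"
proof -
  interpret product_sigma_finite "\<lambda>_::'a. lborel :: real measure"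
    by standard
  have [measurable]: "f b \<in> borel_measurable borel" if "b \<in> Basis" for b
    using assms[OF that] by auto
  have "(\<integral>x. (\<Prod>b\<in>Basis. f b (x \<bullet> b)) \<partial>lborel) =
      (\<integral>g. (\<Prod>b\<in>Basis. f b ((\<Sum>b\<in>Basis. g b *\<^sub>R b) \<bullet> b)) \<partial>(\<Pi>\<^sub>M b\<in>Basis. lborel))"
    by (subst lborel_eq, subst integral_distr) simp_all
  also have "\<dots> = (\<integral>g. (\<Prod>b\<in>Basis. f b (g b)) \<partial>(\<Pi>\<^sub>M b\<in>Basis. lborel))"
    by (intro Bochner_Integration.integral_cong prod.cong) simp_all
  also have "\<dots> = (\<Prod>b\<in>Basis. integral\<^sup>L lborel (f b))"
    using assms by (rule product_integral_prod[OF finite_Basis])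
  finally show ?thesis .
qed

text \<open>The exponential of the inner product factors over the coordinates, and each factor
  integrates to the characteristic function of the standard normal law.\<close>

lemma integral_std_gaussian_iexp:
  fixes z :: "'a::euclidean_space"
  shows "(\<integral>x. iexp (x \<bullet> z) \<partial>std_gaussian) = complex_of_real (exp (- (norm z)\<^sup>2 / 2))"
proof -
  let ?f = "\<lambda>b t. std_normal_density t *\<^sub>R iexp ((z \<bullet> b) * t)"
  have char: "integral\<^sup>L lborel (?f b) = complex_of_real (exp (- (z \<bullet> b)\<^sup>2 / 2))" for b
    using fun_cong[OF char_std_normal_distribution, of "z \<bullet> b"]
    by (simp add: char_def integral_density)
  have int: "integrable lborel (?f b)" for b
    by (rule Bochner_Integration.integrable_bound[OF integrable_normal_density[of 1 0]]) auto
  have "(\<integral>x. iexp (x \<bullet> z) \<partial>std_gaussian) =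
      (\<integral>x. (\<Prod>b\<in>Basis. std_normal_density (x \<bullet> b)) *\<^sub>R iexp (x \<bullet> z) \<partial>lborel)"
    unfolding std_gaussian_def by (rule integral_density) (auto intro!: prod_nonneg)
  also have "\<dots> = (\<integral>x. (\<Prod>b\<in>Basis. ?f b (x \<bullet> b)) \<partial>lborel)"
  proof (intro Bochner_Integration.integral_cong refl)
    fix x :: 'a
    have "\<i> * complex_of_real (x \<bullet> z) = (\<Sum>b\<in>Basis. \<i> * complex_of_real ((z \<bullet> b) * (x \<bullet> b)))"
      by (subst euclidean_inner) (simp add: sum_distrib_left mult_ac)
    then have "iexp (x \<bullet> z) = (\<Prod>b\<in>Basis. iexp ((z \<bullet> b) * (x \<bullet> b)))"
      by (simp only: exp_sum finite_Basis)
    then show "(\<Prod>b\<in>Basis. std_normal_density (x \<bullet> b)) *\<^sub>R iexp (x \<bullet> z) = (\<Prod>b\<in>Basis. ?f b (x \<bullet> b))"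
      by (simp only: scaleR_conv_of_real of_real_prod prod.distrib)
  qed
  also have "\<dots> = (\<Prod>b\<in>Basis. complex_of_real (exp (- (z \<bullet> b)\<^sup>2 / 2)))"
    by (subst integral_lborel_prod[OF int]) (simp only: char)
  also have "\<dots> = complex_of_real (exp (- (norm z)\<^sup>2 / 2))"
    by (simp only: of_real_prod[symmetric] prod_exp_neg_half_inner_power2)
  finally show ?thesis .
qed

lemma integral_std_gaussian_cos:
  fixes z :: "'a::euclidean_space"
  shows "(\<integral>x. cos (x \<bullet> z) \<partial>std_gaussian) = exp (- (norm z)\<^sup>2 / 2)"
proof -
  interpret prob_space "std_gaussian :: 'a measure"
    by (rule prob_space_std_gaussian)
  have "integrable std_gaussian (\<lambda>x. iexp (x \<bullet> z))"
    by (intro integrable_const_bound[where B=1]) auto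
  then have "(\<integral>x. Re (iexp (x \<bullet> z)) \<partial>std_gaussian) = Re (\<integral>x. iexp (x \<bullet> z) \<partial>std_gaussian)"
    by simp
  then show ?thesis
    by (simp only: integral_std_gaussian_iexp) (simp add: Re_exp)
qed

text \<open>A law is determined by its characteristic function, and that of
  \<open>x \<bullet> z\<close> at \<open>t\<close> is the Gaussian transform at
  \<open>t *\<^sub>R z\<close>, a vector of norm \<open>\<bar>t\<bar>\<close>.\<close>

lemma distr_std_gaussian_inner:
  fixes z :: "'a::euclidean_space"
  assumes "norm z = 1"
  shows "distr std_gaussian borel (\<lambda>x. x \<bullet> z) = std_normal_distribution"
proof (rule Levy_uniqueness)
  interpret prob_space "std_gaussian :: 'a measure"
    by (rule prob_space_std_gaussian)
  show "real_distribution (distr std_gaussian borel (\<lambda>x. x \<bullet> z))"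
    by (rule real_distribution_distr) simp
  show "real_distribution std_normal_distribution"
    by (rule real_dist_normal_dist)
  show "char (distr std_gaussian borel (\<lambda>x. x \<bullet> z)) = char std_normal_distribution"
  proof
    fix t
    have "char (distr std_gaussian borel (\<lambda>x. x \<bullet> z)) t = (\<integral>x. iexp (x \<bullet> (t *\<^sub>R z)) \<partial>std_gaussian)"
      by (simp add: char_def integral_distr)
    then show "char (distr std_gaussian borel (\<lambda>x. x \<bullet> z)) t = char std_normal_distribution t"
      using assms by (simp only: integral_std_gaussian_iexp) (simp add: char_std_normal_distribution)
  qed
qed

text \<open>Scaling reduces to the unit vector \<open>sgn z\<close>, where the first absolute moment
  of the standard normal law gives the constant.\<close>

lemma integral_std_gaussian_abs_inner:
  fixes z :: "'a::euclidean_space"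
  shows "(\<integral>x. \<bar>x \<bullet> z\<bar> \<partial>std_gaussian) = sqrt (2 / pi) * norm z"
proof (cases "z = 0")
  case False
  have "(\<integral>x. \<bar>x \<bullet> z\<bar> \<partial>std_gaussian) = (\<integral>x. norm z * \<bar>x \<bullet> sgn z\<bar> \<partial>std_gaussian)"
    using False by (intro Bochner_Integration.integral_cong) (auto simp: sgn_div_norm abs_mult)
  also have "\<dots> = norm z * (\<integral>t. \<bar>t\<bar> \<partial>distr std_gaussian borel (\<lambda>x. x \<bullet> sgn z))"
    by (simp add: integral_distr)
  also have "distr std_gaussian borel (\<lambda>x. x \<bullet> sgn z) = std_normal_distribution"
    using False by (intro distr_std_gaussian_inner) (simp add: norm_sgn)
  also have "(\<integral>t. \<bar>t\<bar> \<partial>std_normal_distribution) = sqrt (2 / pi)"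
    using integral_std_normal_moment_abs_odd[of 0] by (simp add: integral_density)
  finally show ?thesis
    by simp
qed simp

text \<open>Independence of direction and length. The Gaussian density depends on the norm alone, so
  on a rectangle \<open>A \<times> B\<close> it can be absorbed into the radial factor of
  \<open>nn_integral_polar\<close>.\<close>

lemma distr_std_gaussian_sgn_norm:
  "distr (std_gaussian :: 'a::euclidean_space measure) (borel \<Otimes>\<^sub>M borel) (\<lambda>x. (sgn x, norm x)) =
    sphere_uniform \<Otimes>\<^sub>M distr (std_gaussian :: 'a measure) borel norm"
proof (rule pair_measure_eqI[symmetric])
  interpret G: prob_space "std_gaussian :: 'a measure"
    by (rule prob_space_std_gaussian)
  interpret S: prob_space "sphere_uniform :: 'a measure"
    by (rule prob_space_sphere_uniform)
  show "sigma_finite_measure (sphere_uniform :: 'a measure)"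
    by (rule S.sigma_finite_measure_axioms)
  interpret R: prob_space "distr (std_gaussian :: 'a measure) borel norm"
    by (rule G.prob_space_distr) simp
  show "sigma_finite_measure (distr (std_gaussian :: 'a measure) borel norm)"
    by (rule R.sigma_finite_measure_axioms)
  have sets: "sets (sphere_uniform :: 'a measure) = sets borel"
    by (simp add: sphere_uniform_def)
  show "sets ((sphere_uniform :: 'a measure) \<Otimes>\<^sub>M distr (std_gaussian :: 'a measure) borel norm) =
      sets (distr (std_gaussian :: 'a measure) (borel \<Otimes>\<^sub>M borel) (\<lambda>x. (sgn x, norm x)))"
    using sets by (simp cong: sets_pair_measure_cong)
  fix A :: "'a set" and B :: "real set"
  assume "A \<in> sets sphere_uniform" "B \<in> sets (distr (std_gaussian :: 'a measure) borel norm)"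
  then have [measurable]: "A \<in> sets borel" "B \<in> sets borel"
    by (simp_all add: sets)
  define \<phi> where "\<phi> r = ennreal ((1 / sqrt (2 * pi)) ^ DIM('a) * exp (- r\<^sup>2 / 2))" for r :: real
  have [measurable]: "\<phi> \<in> borel_measurable borel"
    unfolding \<phi>_def by measurable
  have G: "(\<integral>\<^sup>+x. f x \<partial>std_gaussian) = (\<integral>\<^sup>+x. \<phi> (norm x) * f x \<partial>lborel)"
    if "f \<in> borel_measurable borel" for f :: "'a \<Rightarrow> ennreal"
    unfolding std_gaussian_altdef \<phi>_def using that by (subst nn_integral_density) auto
  have "emeasure (distr (std_gaussian :: 'a measure) (borel \<Otimes>\<^sub>M borel) (\<lambda>x. (sgn x, norm x))) (A \<times> B) =
      (\<integral>\<^sup>+p. indicator (A \<times> B) p \<partial>distr (std_gaussian :: 'a measure) (borel \<Otimes>\<^sub>M borel) (\<lambda>x. (sgn x, norm x)))"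
    by (rule nn_integral_indicator[symmetric]) simp
  also have "\<dots> = (\<integral>\<^sup>+x. indicator A (sgn x) * indicator B (norm x) \<partial>(std_gaussian :: 'a measure))"
    by (simp add: nn_integral_distr indicator_times)
  also have "\<dots> = (\<integral>\<^sup>+x. indicator A (sgn x) * (\<phi> (norm x) * indicator B (norm x)) \<partial>(lborel :: 'a measure))"
    by (subst G) (simp_all add: mult_ac)
  also have "\<dots> = emeasure sphere_uniform A * (\<integral>\<^sup>+x. \<phi> (norm x) * indicator B (norm x) \<partial>(lborel :: 'a measure))"
    by (rule nn_integral_polar[of A "\<lambda>r. \<phi> r * indicator B r"]) simp_all
  also have "(\<integral>\<^sup>+x. \<phi> (norm x) * indicator B (norm x) \<partial>(lborel :: 'a measure)) = (\<integral>\<^sup>+x. indicator B (norm x) \<partial>(std_gaussian :: 'a measure))"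
    by (subst G) simp_all
  also have "\<dots> = (\<integral>\<^sup>+r. indicator B r \<partial>distr (std_gaussian :: 'a measure) borel norm)"
    by (rule nn_integral_distr[symmetric]) simp_all
  also have "\<dots> = emeasure (distr (std_gaussian :: 'a measure) borel norm) B"
    by (rule nn_integral_indicator) simp
  finally show "emeasure sphere_uniform A * emeasure (distr (std_gaussian :: 'a measure) borel norm) B =
      emeasure (distr (std_gaussian :: 'a measure) (borel \<Otimes>\<^sub>M borel) (\<lambda>x. (sgn x, norm x))) (A \<times> B)" ..
qed

text \<open>Fubini for the product law of direction and length. The length is averaged first, so
  that the inner integral can be a one-dimensional kernel evaluated along the direction
  \<open>\<xi>\<close>.\<close>

lemma integral_std_gaussian_sgn_norm:
  fixes f :: "'a::euclidean_space \<Rightarrow> real \<Rightarrow> real"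
  assumes [measurable]: "case_prod f \<in> borel_measurable (borel \<Otimes>\<^sub>M borel)"
    and int: "integrable std_gaussian (\<lambda>x. f (sgn x) (norm x))"
  shows "(\<integral>x. f (sgn x) (norm x) \<partial>std_gaussian) =
    (\<integral>\<xi>. (\<integral>x. f \<xi> (norm x) \<partial>(std_gaussian :: 'a measure)) \<partial>sphere_uniform)"
    and "integrable sphere_uniform (\<lambda>\<xi>. \<integral>x. f \<xi> (norm x) \<partial>(std_gaussian :: 'a measure))"
proof -
  interpret G: prob_space "std_gaussian :: 'a measure"
    by (rule prob_space_std_gaussian)
  interpret S: prob_space "sphere_uniform :: 'a measure"
    by (rule prob_space_sphere_uniform)
  let ?R = "distr (std_gaussian :: 'a measure) borel norm"
  interpret R: prob_space ?R
    by (rule G.prob_space_distr) simp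
  interpret P: pair_sigma_finite "sphere_uniform :: 'a measure" ?R ..
  have inner: "(\<integral>r. f \<xi> r \<partial>?R) = (\<integral>x. f \<xi> (norm x) \<partial>(std_gaussian :: 'a measure))" for \<xi>
    by (rule integral_distr) simp_all
  have "integrable (sphere_uniform \<Otimes>\<^sub>M ?R) (case_prod f)"
    unfolding distr_std_gaussian_sgn_norm[symmetric] using int by (subst integrable_distr_eq) auto
  from P.integral_fst'[OF this] P.integrable_fst'[OF this]
  show "(\<integral>x. f (sgn x) (norm x) \<partial>std_gaussian) =
    (\<integral>\<xi>. (\<integral>x. f \<xi> (norm x) \<partial>(std_gaussian :: 'a measure)) \<partial>sphere_uniform)"
    and "integrable sphere_uniform (\<lambda>\<xi>. \<integral>x. f \<xi> (norm x) \<partial>(std_gaussian :: 'a measure))"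
    unfolding distr_std_gaussian_sgn_norm[symmetric] by (simp_all add: integral_distr inner)
qed

subsection \<open>Mean error of the empirical mean\<close>

text \<open>This is nonnegativity of the variance of \<open>\<bar>X\<bar>\<close>.\<close>

lemma (in prob_space) expectation_abs_le_sqrt:
  fixes X :: "'a \<Rightarrow> real"
  assumes [measurable]: "random_variable borel X" and "integrable M (\<lambda>x. (X x)\<^sup>2)"
  shows "expectation (\<lambda>x. \<bar>X x\<bar>) \<le> sqrt (expectation (\<lambda>x. (X x)\<^sup>2))"
proof -
  have "integrable M X"
    using assms by (rule square_integrable_imp_integrable)
  then have "0 \<le> expectation (\<lambda>x. (X x)\<^sup>2) - (expectation (\<lambda>x. \<bar>X x\<bar>))\<^sup>2"
    using variance_positive[of "\<lambda>x. \<bar>X x\<bar>"] assms(2) by (subst (asm) variance_eq) auto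
  then have "(expectation (\<lambda>x. \<bar>X x\<bar>))\<^sup>2 \<le> expectation (\<lambda>x. (X x)\<^sup>2)"
    by linarith
  then show ?thesis
    by (rule real_le_rsqrt)
qed

text \<open>By independence the variance of the sum is the sum of the variances, each at most
  \<open>B\<^sup>2\<close>; the standard deviation of the mean is therefore at most
  \<open>B / sqrt n\<close> for \<open>n\<close> summands. The bound is required only almost
  everywhere since the negative distance kernel is bounded on the sphere but not on the whole
  space.\<close>

lemma (in prob_space) expectation_abs_mean_deviation:
  fixes Y :: "'i \<Rightarrow> 'a \<Rightarrow> real"
  assumes I: "finite I" "I \<noteq> {}"
    and indep: "indep_vars (\<lambda>_. borel) Y I"
    and bound: "\<And>i. i \<in> I \<Longrightarrow> AE \<omega> in M. \<bar>Y i \<omega>\<bar> \<le> B"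
    and mean: "\<And>i. i \<in> I \<Longrightarrow> expectation (Y i) = m"
  shows "integrable M (\<lambda>\<omega>. \<bar>(\<Sum>i\<in>I. Y i \<omega>) / real (card I) - m\<bar>)"
    and "expectation (\<lambda>\<omega>. \<bar>(\<Sum>i\<in>I. Y i \<omega>) / real (card I) - m\<bar>) \<le> B / sqrt (real (card I))"
proof -
  let ?n = "real (card I)"
  have n: "?n > 0"
    using I by (simp add: card_gt_0_iff)
  define Z where "Z i \<omega> = Y i \<omega> - m" for i \<omega>
  have Y_meas: "random_variable borel (Y i)" if "i \<in> I" for i
    using indep that by (auto simp: indep_vars_def)
  have Y_int: "integrable M (Y i)" if "i \<in> I" for i
    using bound[OF that] Y_meas[OF that] by (intro integrable_const_bound[where B=B]) auto
  have "indep_vars (\<lambda>_. borel) (\<lambda>i \<omega>. Y i \<omega> - m) I"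
    by (rule indep_vars_compose2[OF indep]) auto
  then have Z_indep: "indep_vars (\<lambda>_. borel) Z I"
    by (simp add: Z_def[abs_def])
  have Z_int: "integrable M (Z i)" if "i \<in> I" for i
    unfolding Z_def using Y_int[OF that] by simp
  have Z_mean: "expectation (Z i) = 0" if "i \<in> I" for i
    unfolding Z_def using Y_int[OF that] mean[OF that] by (simp add: prob_space)
  \<comment> \<open>Centred independent variables are uncorrelated, so mixed terms vanish.\<close>
  have off_diag: "integrable M (\<lambda>\<omega>. Z i \<omega> * Z j \<omega>)" "expectation (\<lambda>\<omega>. Z i \<omega> * Z j \<omega>) = 0"
    if "i \<in> I" "j \<in> I" "i \<noteq> j" for i j
  proof -
    have "indep_vars (\<lambda>_. borel) Z {i, j}"
      using Z_indep by (rule indep_vars_subset) (use that in auto)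
    from indep_vars_integrable[OF _ this] indep_vars_lebesgue_integral[OF _ this]
    show "integrable M (\<lambda>\<omega>. Z i \<omega> * Z j \<omega>)" "expectation (\<lambda>\<omega>. Z i \<omega> * Z j \<omega>) = 0"
      using that Z_int Z_mean by auto
  qed
  \<comment> \<open>A variance is at most the second moment; estimating \<open>Z i\<close> directly
    by \<open>2 * B\<close> would lose a factor.\<close>
  have diag: "integrable M (\<lambda>\<omega>. Z i \<omega> * Z i \<omega>)" "expectation (\<lambda>\<omega>. Z i \<omega> * Z i \<omega>) \<le> B\<^sup>2"
    if i: "i \<in> I" for i
  proof -
    have bd: "AE \<omega> in M. (Y i \<omega>)\<^sup>2 \<le> B\<^sup>2"
      using bound[OF i] by eventually_elim (metis abs_ge_zero power2_abs power_mono)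
    have Y2: "integrable M (\<lambda>\<omega>. (Y i \<omega>)\<^sup>2)"
      using bd Y_meas[OF i] by (intro integrable_const_bound[where B="B\<^sup>2"]) auto
    have eq: "Z i \<omega> * Z i \<omega> = (Y i \<omega>)\<^sup>2 - (2 * m) * Y i \<omega> + m\<^sup>2" for \<omega>
      by (simp add: Z_def power2_eq_square algebra_simps)
    show "integrable M (\<lambda>\<omega>. Z i \<omega> * Z i \<omega>)"
      unfolding eq using Y2 Y_int[OF i] by simp
    have "expectation (\<lambda>\<omega>. Z i \<omega> * Z i \<omega>) = expectation (\<lambda>\<omega>. (Y i \<omega>)\<^sup>2) - m\<^sup>2"
      unfolding eq using Y2 Y_int[OF i] mean[OF i] by (simp add: prob_space power2_eq_square)
    also have "\<dots> \<le> expectation (\<lambda>\<omega>. (Y i \<omega>)\<^sup>2)"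
      by simp
    also have "\<dots> \<le> expectation (\<lambda>\<omega>. B\<^sup>2)"
      using Y2 bd by (intro integral_mono_AE) auto
    finally show "expectation (\<lambda>\<omega>. Z i \<omega> * Z i \<omega>) \<le> B\<^sup>2"
      by (simp add: prob_space)
  qed
  define S where "S \<omega> = (\<Sum>i\<in>I. Z i \<omega>)" for \<omega>
  have S2: "(S \<omega>)\<^sup>2 = (\<Sum>i\<in>I. \<Sum>j\<in>I. Z i \<omega> * Z j \<omega>)" for \<omega>
    by (simp add: S_def power2_eq_square sum_product)
  have ZZ: "integrable M (\<lambda>\<omega>. Z i \<omega> * Z j \<omega>)" if "i \<in> I" "j \<in> I" for i j
    using diag off_diag that by (cases "i = j") auto
  have S_meas [measurable]: "random_variable borel S"
    unfolding S_def using Z_int by (intro borel_measurable_sum) auto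
  have S2_int: "integrable M (\<lambda>\<omega>. (S \<omega>)\<^sup>2)"
    unfolding S2 using ZZ by (intro Bochner_Integration.integrable_sum) auto
  have "expectation (\<lambda>\<omega>. (S \<omega>)\<^sup>2) = (\<Sum>i\<in>I. \<Sum>j\<in>I. expectation (\<lambda>\<omega>. Z i \<omega> * Z j \<omega>))"
    unfolding S2 using ZZ by simp
  also have "\<dots> = (\<Sum>i\<in>I. \<Sum>j\<in>I. if j = i then expectation (\<lambda>\<omega>. Z i \<omega> * Z i \<omega>) else 0)"
    using off_diag by (intro sum.cong refl) auto
  also have "\<dots> = (\<Sum>i\<in>I. expectation (\<lambda>\<omega>. Z i \<omega> * Z i \<omega>))"
    using I by simp
  also have "\<dots> \<le> ?n * B\<^sup>2"
    using sum_bounded_above[of I _ "B\<^sup>2", OF diag(2)] by simp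
  finally have ES2: "expectation (\<lambda>\<omega>. (S \<omega>)\<^sup>2) \<le> ?n * B\<^sup>2" .
  \<comment> \<open>The sign is needed to rewrite \<open>sqrt (B\<^sup>2)\<close> as
    \<open>B\<close>. It follows because an almost sure statement free of \<open>\<omega>\<close> is
    true in a probability space.\<close>
  have B: "B \<ge> 0"
  proof -
    obtain i where "i \<in> I" using I by blast
    from bound[OF this] have "AE \<omega> in M. 0 \<le> B"
      by eventually_elim linarith
    then show ?thesis by simp
  qed
  have dev: "(\<Sum>i\<in>I. Y i \<omega>) / ?n - m = S \<omega> / ?n" for \<omega>
    using n by (simp add: S_def Z_def sum_subtractf field_simps)
  have S_int: "integrable M S"
    using S_meas S2_int by (rule square_integrable_imp_integrable)
  show "integrable M (\<lambda>\<omega>. \<bar>(\<Sum>i\<in>I. Y i \<omega>) / real (card I) - m\<bar>)"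
    unfolding dev using S_int by simp
  have "expectation (\<lambda>\<omega>. \<bar>S \<omega>\<bar>) \<le> sqrt (?n * B\<^sup>2)"
    using expectation_abs_le_sqrt[OF S_meas S2_int] ES2 by (meson order.trans real_sqrt_le_mono)
  then have "expectation (\<lambda>\<omega>. \<bar>S \<omega>\<bar>) / ?n \<le> sqrt ?n * B / ?n"
    using n B by (intro divide_right_mono) (auto simp: real_sqrt_mult)
  also have "\<dots> = B / sqrt ?n"
    using n by (simp add: field_simps flip: real_sqrt_mult)
  finally show "expectation (\<lambda>\<omega>. \<bar>(\<Sum>i\<in>I. Y i \<omega>) / real (card I) - m\<bar>) \<le> B / sqrt (real (card I))"
    unfolding dev by simp
qed

text \<open>The summands are the same measurable function of independent directions, and
  \<open>one_dim_counterpart\<close> says that their common mean is \<open>K x y\<close>. Both parts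
  of the theorem are instances with a suitable \<open>B\<close>.\<close>

lemma sliced_estimator_mean_error:
  fixes K :: "'a::euclidean_space \<Rightarrow> 'a \<Rightarrow> real"
  assumes "prob_space M" "P \<ge> 1"
    and indep: "prob_space.indep_vars M (\<lambda>_. borel) \<xi> {1..P}"
    and distr: "\<forall>p\<in>{1..P}. distr M borel (\<xi> p) = sphere_uniform"
    and K: "one_dim_counterpart K k"
    and bound: "AE v in sphere_uniform. \<bar>k (v \<bullet> x) (v \<bullet> y)\<bar> \<le> B"
  shows "integrable M (\<lambda>\<omega>. \<bar>sliced_estimator k P (\<lambda>p. \<xi> p \<omega>) x y - K x y\<bar>)"
    and "(LINT \<omega>|M. \<bar>sliced_estimator k P (\<lambda>p. \<xi> p \<omega>) x y - K x y\<bar>) \<le> B / sqrt (real P)"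
proof -
  interpret prob_space M by fact
  define Y where "Y p \<omega> = k (\<xi> p \<omega> \<bullet> x) (\<xi> p \<omega> \<bullet> y)" for p \<omega>
  have [measurable]: "(\<lambda>(s, t). k s t) \<in> borel_measurable (borel \<Otimes>\<^sub>M borel)"
    using K by (simp add: one_dim_counterpart_def)
  have k_meas [measurable]: "(\<lambda>v. k (v \<bullet> x) (v \<bullet> y)) \<in> borel_measurable borel"
    by measurable
  have Y_indep: "indep_vars (\<lambda>_. borel) Y {1..P}"
    using indep_vars_compose2[OF indep, of "\<lambda>_ v. k (v \<bullet> x) (v \<bullet> y)" "\<lambda>_. borel"]
    by (simp add: Y_def[abs_def])
  have \<xi>_meas [measurable]: "\<xi> p \<in> borel_measurable M" if "p \<in> {1..P}" for p
    using indep that by (auto simp: indep_vars_def)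
  have Y_bound: "AE \<omega> in M. \<bar>Y p \<omega>\<bar> \<le> B" if p: "p \<in> {1..P}" for p
  proof -
    from bound have "AE v in distr M borel (\<xi> p). \<bar>k (v \<bullet> x) (v \<bullet> y)\<bar> \<le> B"
      by (simp only: distr[rule_format, OF p])
    then show ?thesis
      unfolding Y_def using \<xi>_meas[OF p] by (subst (asm) AE_distr_iff) auto
  qed
  have Y_mean: "expectation (Y p) = K x y" if p: "p \<in> {1..P}" for p
  proof -
    have "expectation (Y p) = (LINT v|distr M borel (\<xi> p). k (v \<bullet> x) (v \<bullet> y))"
      unfolding Y_def using \<xi>_meas[OF p] by (subst integral_distr) auto
    also have "\<dots> = K x y"
      using K by (simp only: distr[rule_format, OF p]) (simp add: one_dim_counterpart_def)
    finally show ?thesis .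
  qed
  have eq: "sliced_estimator k P (\<lambda>p. \<xi> p \<omega>) x y = (\<Sum>p\<in>{1..P}. Y p \<omega>) / real (card {1..P})" for \<omega>
    by (simp add: sliced_estimator_def Y_def)
  show "integrable M (\<lambda>\<omega>. \<bar>sliced_estimator k P (\<lambda>p. \<xi> p \<omega>) x y - K x y\<bar>)"
    unfolding eq using \<open>P \<ge> 1\<close>
    by (intro expectation_abs_mean_deviation(1)[OF _ _ Y_indep Y_bound Y_mean]) auto
  show "(LINT \<omega>|M. \<bar>sliced_estimator k P (\<lambda>p. \<xi> p \<omega>) x y - K x y\<bar>) \<le> B / sqrt (real P)"
    unfolding eq using \<open>P \<ge> 1\<close> expectation_abs_mean_deviation(2)[OF _ _ Y_indep Y_bound Y_mean]
    by simp
qed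

subsection \<open>Gamma function and moments of the norm\<close>

text \<open>Log-convexity of Gamma at the midpoint of \<open>x\<close> and \<open>x + 1\<close>,
  combined with the functional equation.\<close>

lemma Gamma_plus_half_le:
  fixes x :: real
  assumes "x > 0"
  shows "Gamma (x + 1/2) \<le> sqrt x * Gamma x"
proof -
  have "convex_on {0<..} (ln \<circ> Gamma :: real \<Rightarrow> real)"
    by (rule log_convex_Gamma_real)
  from convex_onD[OF this, of "1/2" x "x + 1"] assms
  have "ln (Gamma (x + 1/2)) \<le> (ln (Gamma x) + ln (Gamma (x + 1))) / 2"
    by (simp add: algebra_simps add_divide_distrib)
  also have "Gamma (x + 1) = x * Gamma x"
    using assms by (intro Gamma_plus1) (auto elim!: nonpos_Ints_cases)
  also have "(ln (Gamma x) + ln (x * Gamma x)) / 2 = ln (sqrt x * Gamma x)"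
    using assms Gamma_real_pos[OF assms] by (simp add: ln_mult ln_sqrt)
  finally show ?thesis
    using assms by (simp add: Gamma_real_pos)
qed

text \<open>With \<open>x\<close> the dimension, this is the source of the growth rate
  \<open>sqrt d\<close> in the negative distance bound.\<close>

lemma Gamma_ratio_le:
  fixes x :: real
  assumes "x > 0"
  shows "Gamma ((x + 1) / 2) / Gamma (x / 2) \<le> sqrt x"
proof -
  have "Gamma ((x + 1) / 2) \<le> sqrt (x / 2) * Gamma (x / 2)"
    using Gamma_plus_half_le[of "x / 2"] assms by (simp add: add_divide_distrib)
  also have "\<dots> \<le> sqrt x * Gamma (x / 2)"
    using assms by (intro mult_right_mono) (auto intro!: less_imp_le Gamma_real_pos)
  finally show ?thesis
    using assms by (simp add: divide_le_eq Gamma_real_pos)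
qed

text \<open>Translates between factorials and half-integer Gamma values, both in the normal moments
  and in the coefficients of the hypergeometric series.\<close>

lemma Gamma_nat_plus_half:
  "Gamma (real n + 1/2) = fact (2 * n) / (4 ^ n * fact n) * sqrt pi"
proof (induction n)
  case (Suc n)
  have step: "Gamma (real (Suc n) + 1/2) = (real n + 1/2) * Gamma (real n + 1/2)"
    using Gamma_plus1[of "real n + 1/2"] by (force elim!: nonpos_Ints_cases simp: add_ac)
  have "fact (2 * Suc n) = 2 * (real n + 1) * (2 * real n + 1) * fact (2 * n)"
    and "fact (Suc n) = (real n + 1) * fact n"
    by (simp_all add: algebra_simps)
  moreover have "real n + 1 \<noteq> 0"
    by linarith
  ultimately show ?case
    by (simp only: step Suc.IH power_Suc) (simp add: divide_simps, simp add: algebra_simps)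
qed (simp add: Gamma_one_half_real)

text \<open>A single Gamma expression covers the separate formulas for even and odd moments: Gamma
  is taken at a half-integer for even \<open>q\<close> and at an integer for odd
  \<open>q\<close>.\<close>

lemma std_normal_abs_moment:
  "has_bochner_integral lborel (\<lambda>x. std_normal_density x * \<bar>x\<bar> ^ q)
    (sqrt 2 ^ q * Gamma ((real q + 1) / 2) / sqrt pi)"
proof (cases "even q")
  case True
  then obtain k where q: "q = 2 * k" by blast
  have "\<bar>x\<bar> ^ q = x ^ (2 * k)" for x :: real
    by (simp add: q power_mult)
  moreover have "sqrt 2 ^ q * Gamma ((real q + 1) / 2) / sqrt pi = fact (2 * k) / (2 ^ k * fact k)"
  proof -
    have "(real q + 1) / 2 = real k + 1 / 2" and "sqrt 2 ^ q = 2 ^ k"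
      by (simp_all add: q power_mult add_divide_distrib)
    moreover have "(4::real) ^ k = 2 ^ k * 2 ^ k"
      by (simp flip: power_mult_distrib)
    ultimately show ?thesis
      by (simp only: Gamma_nat_plus_half) simp
  qed
  ultimately show ?thesis
    using std_normal_moment_even[of k] by simp
next
  case False
  then obtain k where q: "q = 2 * k + 1" by (elim oddE)
  have "(real q + 1) / 2 = 1 + real k"
    by (simp add: q)
  then have "Gamma ((real q + 1) / 2) = fact k"
    by (simp only: Gamma_fact)
  then have "sqrt 2 ^ q * Gamma ((real q + 1) / 2) / sqrt pi = sqrt (2 / pi) * 2 ^ k * fact k"
    by (simp only:) (simp add: q power_mult real_sqrt_divide)
  then show ?thesis
    using std_normal_moment_abs_odd[of k] by (simp add: q)
qed

lemma nn_integral_half_line_moment: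
  "(\<integral>\<^sup>+r. ennreal (indicator {0..} r * r ^ q * std_normal_density r) \<partial>lborel) =
    ennreal (sqrt 2 ^ q * Gamma ((real q + 1) / 2) / (2 * sqrt pi))" (is "?J = _")
proof -
  have int: "(\<integral>\<^sup>+x. ennreal (std_normal_density x * \<bar>x\<bar> ^ q) \<partial>lborel) =
      ennreal (sqrt 2 ^ q * Gamma ((real q + 1) / 2) / sqrt pi)"
    using std_normal_abs_moment[of q]
    by (subst nn_integral_eq_integral) (auto simp: has_bochner_integral_iff)
  \<comment> \<open>The radial formula in dimension 1 is the reflection symmetry of the integrand.\<close>
  have "emeasure lborel (cball (0::real) 1) = 2"
    by (simp add: cball_eq_atLeastAtMost)
  then have "(\<integral>\<^sup>+x. ennreal (norm x ^ q * std_normal_density (norm x)) \<partial>(lborel :: real measure)) =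
      2 * (\<integral>\<^sup>+r. ennreal (indicator {0..} r) * ennreal (r ^ q * std_normal_density r) \<partial>lborel)"
    by (subst nn_integral_radial) simp_all
  also have "(\<integral>\<^sup>+r. ennreal (indicator {0..} r) * ennreal (r ^ q * std_normal_density r) \<partial>lborel) = ?J"
    by (intro nn_integral_cong) (auto simp: indicator_def)
  also have "(\<integral>\<^sup>+x. ennreal (norm x ^ q * std_normal_density (norm x)) \<partial>(lborel :: real measure)) =
      (\<integral>\<^sup>+x. ennreal (std_normal_density x * \<bar>x\<bar> ^ q) \<partial>lborel)"
    by (intro nn_integral_cong) (simp add: std_normal_density_def mult_ac)
  finally have "2 * ?J = ennreal (sqrt 2 ^ q * Gamma ((real q + 1) / 2) / sqrt pi)"
    by (simp add: int)
  also have "\<dots> = 2 * ennreal (sqrt 2 ^ q * Gamma ((real q + 1) / 2) / (2 * sqrt pi))"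
    by (subst ennreal_numeral[symmetric], subst ennreal_mult'[symmetric]) simp_all
  finally show ?thesis
    by (simp add: ennreal_mult_cancel_left)
qed

text \<open>In polar coordinates the moment is a constant times a half-line normal moment of order
  \<open>D - 1 + m\<close>. The constant is the same for all \<open>m\<close>, and total mass 1, the
  case \<open>m = 0\<close>, determines it.\<close>

lemma has_bochner_integral_std_gaussian_norm_power:
  "has_bochner_integral std_gaussian (\<lambda>x::'a::euclidean_space. norm x ^ m)
    (sqrt 2 ^ m * Gamma ((real DIM('a) + real m) / 2) / Gamma (real DIM('a) / 2))"
proof -
  interpret G: prob_space "std_gaussian :: 'a measure"
    by (rule prob_space_std_gaussian)
  define D where "D = DIM('a)"
  have D: "D > 0" "real (D - 1) + 1 = real D"
    by (auto simp: D_def)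
  \<comment> \<open>Of the \<open>D\<close> factors \<open>1 / sqrt (2 * pi)\<close> in the density,
    one belongs to \<open>std_normal_density\<close> and the other \<open>D - 1\<close> are kept
    here.\<close>
  define c where "c = emeasure lborel (cball (0::'a) 1) * of_nat D * ennreal ((1 / sqrt (2 * pi)) ^ (D - 1))"
  define g where "g m = sqrt 2 ^ (D - 1 + m) * Gamma ((real D + real m) / 2) / (2 * sqrt pi)" for m
  have Gamma_pos: "Gamma ((real D + real m) / 2) > 0" for m
    using D by (intro Gamma_real_pos) auto
  then have g_pos: "g m > 0" for m
    unfolding g_def by simp
  have moment: "(\<integral>\<^sup>+x. ennreal (norm x ^ m) \<partial>(std_gaussian :: 'a measure)) = c * ennreal (g m)" for m
  proof -
    let ?h = "\<lambda>r. ennreal ((1 / sqrt (2 * pi)) ^ D * exp (- r\<^sup>2 / 2)) * ennreal (r ^ m)"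
    have "(\<integral>\<^sup>+x. ennreal (norm x ^ m) \<partial>(std_gaussian :: 'a measure)) = (\<integral>\<^sup>+x. ?h (norm x) \<partial>(lborel :: 'a measure))"
      unfolding std_gaussian_altdef D_def by (subst nn_integral_density) simp_all
    also have "\<dots> = emeasure lborel (cball (0::'a) 1) * of_nat D *
        (\<integral>\<^sup>+r. ennreal (indicator {0..} r * r ^ (D - 1)) * ?h r \<partial>lborel)"
      unfolding D_def by (rule nn_integral_radial) simp
    also have "(\<integral>\<^sup>+r. ennreal (indicator {0..} r * r ^ (D - 1)) * ?h r \<partial>lborel) =
        (\<integral>\<^sup>+r. ennreal ((1 / sqrt (2 * pi)) ^ (D - 1)) *
          ennreal (indicator {0..} r * r ^ (D - 1 + m) * std_normal_density r) \<partial>lborel)"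
    proof (intro nn_integral_cong)
      fix r :: real
      have "(1 / sqrt (2 * pi)) ^ D = (1 / sqrt (2 * pi)) ^ (D - 1) * (1 / sqrt (2 * pi))"
        using D(1) by (simp add: power_eq_if)
      then show "ennreal (indicator {0..} r * r ^ (D - 1)) * ?h r =
          ennreal ((1 / sqrt (2 * pi)) ^ (D - 1)) *
          ennreal (indicator {0..} r * r ^ (D - 1 + m) * std_normal_density r)"
        by (auto simp: indicator_def std_normal_density_def power_add mult_ac simp flip: ennreal_mult')
    qed
    also have "\<dots> = ennreal ((1 / sqrt (2 * pi)) ^ (D - 1)) * ennreal (g m)"
      using D by (subst nn_integral_cmult) (simp_all add: nn_integral_half_line_moment g_def add_ac)
    finally show ?thesis
      by (simp add: c_def mult_ac)
  qed
  have c: "c * ennreal (g 0) = 1"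
    using moment[of 0] G.emeasure_space_1 by simp
  \<comment> \<open>Multiplying by the real inverse of \<open>g 0\<close> replaces division in the
    extended reals, where cancellation is not generally available.\<close>
  have "c = c * (ennreal (g 0) * ennreal (1 / g 0))"
    using g_pos[of 0] by (simp flip: ennreal_mult')
  also have "\<dots> = ennreal (1 / g 0)"
    by (simp only: mult.assoc[symmetric] c) simp
  finally have c_eq: "c = ennreal (1 / g 0)" .
  have "(\<integral>\<^sup>+x. ennreal (norm x ^ m) \<partial>(std_gaussian :: 'a measure)) = ennreal (g m / g 0)"
    using g_pos[of 0] g_pos[of m] by (simp add: moment c_eq flip: ennreal_mult')
  moreover have "g m / g 0 = sqrt 2 ^ m * Gamma ((real D + real m) / 2) / Gamma (real D / 2)"
    by (simp add: g_def power_add)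
  moreover have "0 \<le> g m / g 0"
    using g_pos[of 0] g_pos[of m] by simp
  ultimately show ?thesis
    unfolding D_def[symmetric] by (intro has_bochner_integral_nn_integral) auto
qed

subsection \<open>One-dimensional counterparts\<close>

text \<open>Integrating the cosine series term by term turns even powers of the norm into moments,
  which supply \<open>Gamma (d / 2 + n)\<close>; the factorials \<open>(2 * n)!\<close> become
  \<open>Gamma (1 / 2 + n)\<close>.\<close>

lemma hyp_1F1_eq_integral_cos:
  "hyp_1F1 (real DIM('a) / 2) (1 / 2) (- s\<^sup>2 / 2) =
    (\<integral>x. cos (norm x * s) \<partial>(std_gaussian :: 'a::euclidean_space measure))"
proof -
  define d where "d = real DIM('a)"
  have d: "d \<ge> 1"
    by (simp add: d_def Suc_leI)
  \<comment> \<open>The moment of order \<open>2 * n\<close> of the Gaussian length.\<close>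
  define a where "a n = 2 ^ n * Gamma (d / 2 + real n) / Gamma (d / 2)" for n
  define f where "f n x = (-1) ^ n / fact (2 * n) * (norm (x::'a) * s) ^ (2 * n)" for n x
  have moment: "has_bochner_integral std_gaussian (\<lambda>x::'a. norm x ^ (2 * n)) (a n)" for n
    using has_bochner_integral_std_gaussian_norm_power[where 'a='a, of "2 * n"]
    by (simp add: a_def d_def power_mult add_divide_distrib)
  have Gamma_pos: "Gamma (d / 2 + real n) > 0" for n
    using d by (intro Gamma_real_pos) auto
  have a_pos: "a n > 0" for n
    using Gamma_pos[of 0] Gamma_pos[of n] by (simp add: a_def)
  have a_Suc: "a (Suc n) = (d + 2 * real n) * a n" for n
  proof -
    have step: "Gamma (d / 2 + real (Suc n)) = (d / 2 + real n) * Gamma (d / 2 + real n)"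
      using Gamma_plus1[of "d / 2 + real n"] d by (force elim!: nonpos_Ints_cases simp: add_ac)
    show ?thesis
      by (simp only: a_def step) (simp add: algebra_simps)
  qed
  have f_int: "has_bochner_integral std_gaussian (f n) ((-1) ^ n / fact (2 * n) * s ^ (2 * n) * a n)" for n
    using has_bochner_integral_mult_right[OF moment, of "(-1) ^ n / fact (2 * n) * s ^ (2 * n)" n]
    by (simp add: f_def[abs_def] power_mult_distrib mult_ac)
  have f_norm: "has_bochner_integral std_gaussian (\<lambda>x. norm (f n x)) (s ^ (2 * n) / fact (2 * n) * a n)" for n
  proof -
    have "norm (f n x) = s ^ (2 * n) / fact (2 * n) * norm x ^ (2 * n)" for x
      by (simp add: f_def abs_mult power_abs power_mult power_mult_distrib)
    then show ?thesis
      using has_bochner_integral_mult_right[OF moment, of "s ^ (2 * n) / fact (2 * n)" n] by simp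
  qed
  have "summable (\<lambda>n. s ^ (2 * n) / fact (2 * n) * a n)"
  \<comment> \<open>The ratio of consecutive terms is
    \<open>s\<^sup>2 * (d + 2 * n) / ((2 * n + 2) * (2 * n + 1))\<close>. As
    \<open>d \<ge> 1\<close>, the factor \<open>d + 2 * n\<close> is at most
    \<open>d * (2 * n + 1)\<close>, so the ratio is at most 1/2 once
    \<open>n \<ge> s\<^sup>2 * d\<close>.\<close>
  proof (rule summable_ratio_test[where c="1/2" and N="nat \<lceil>s\<^sup>2 * d\<rceil>"])
    fix n assume "n \<ge> nat \<lceil>s\<^sup>2 * d\<rceil>"
    then have n: "s\<^sup>2 * d \<le> real n"
      by linarith
    have "s\<^sup>2 * (d + 2 * real n) \<le> s\<^sup>2 * (d * (2 * real n + 1))"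
      using d mult_right_mono[of 1 d "2 * real n"] by (intro mult_left_mono) (auto simp: algebra_simps)
    also have "\<dots> = (s\<^sup>2 * d) * (2 * real n + 1)"
      by simp
    also have "\<dots> \<le> (real n + 1) * (2 * real n + 1)"
      using n by (intro mult_right_mono) auto
    finally have ratio: "s\<^sup>2 * (d + 2 * real n) / ((2 * real n + 2) * (2 * real n + 1)) \<le> 1 / 2"
      by (intro mult_imp_div_pos_le) (simp, simp add: algebra_simps)
    have "s ^ (2 * Suc n) / fact (2 * Suc n) * a (Suc n) =
        (s\<^sup>2 * (d + 2 * real n) / ((2 * real n + 2) * (2 * real n + 1))) * (s ^ (2 * n) / fact (2 * n) * a n)"
      by (simp add: a_Suc power2_eq_square mult_ac add_ac)
    also have "\<dots> \<le> 1 / 2 * (s ^ (2 * n) / fact (2 * n) * a n)"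
      using ratio a_pos[of n] by (intro mult_right_mono) auto
    finally show "norm (s ^ (2 * Suc n) / fact (2 * Suc n) * a (Suc n)) \<le> 1 / 2 * norm (s ^ (2 * n) / fact (2 * n) * a n)"
      using a_pos[of n] a_pos[of "Suc n"] by (simp add: power_mult abs_mult)
  qed simp
  then have summable: "summable (\<lambda>n. \<integral>x. norm (f n x) \<partial>std_gaussian)"
    using f_norm by (simp add: has_bochner_integral_iff)
  \<comment> \<open>Pointwise absolute convergence, the second condition for exchanging sum and
    integral, by comparison with the exponential series since \<open>n!\<close> is at most
    \<open>(2 * n)!\<close>.\<close>
  have "summable (\<lambda>n. norm (f n x))" for x
  proof (rule summable_comparison_test')
    show "summable (\<lambda>n. inverse (fact n) * ((norm x * s)\<^sup>2) ^ n)"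
      by (rule summable_exp)
    fix n
    have "norm (f n x) = (norm x * s) ^ (2 * n) / fact (2 * n)"
      by (simp add: f_def abs_mult power_abs power_mult power_mult_distrib)
    also have "\<dots> \<le> (norm x * s) ^ (2 * n) / fact n"
      by (intro divide_left_mono fact_mono) (auto simp: power_mult)
    finally show "norm (norm (f n x)) \<le> inverse (fact n) * ((norm x * s)\<^sup>2) ^ n"
      by (simp add: power_mult divide_inverse_commute)
  qed
  then have "(\<integral>x. (\<Sum>n. f n x) \<partial>std_gaussian) = (\<Sum>n. integral\<^sup>L std_gaussian (f n))"
    using f_int summable by (intro integral_suminf) (auto simp: has_bochner_integral_iff)
  moreover have "(\<Sum>n. f n x) = cos (norm x * s)" for x
    using cos_paired[of "norm x * s"] by (simp add: f_def sums_iff)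
  moreover have "integral\<^sup>L std_gaussian (f n) =
      Gamma (d / 2 + real n) * Gamma (1 / 2) / (Gamma (d / 2) * Gamma (1 / 2 + real n)) * ((- s\<^sup>2 / 2) ^ n / fact n)" for n
  proof -
    have "integral\<^sup>L std_gaussian (f n) = (-1) ^ n / fact (2 * n) * s ^ (2 * n) * a n"
      using f_int by (simp add: has_bochner_integral_iff)
    also have "\<dots> = Gamma (d / 2 + real n) / Gamma (d / 2) * (4 ^ n * fact n / fact (2 * n)) * ((- s\<^sup>2 / 2) ^ n / fact n)"
    proof -
      have "(- s\<^sup>2 / 2) ^ n = (-1) ^ n * s ^ (2 * n) / 2 ^ n"
        by (simp add: power_divide power_mult power_minus[of "s\<^sup>2 / 2"])
      moreover have "(4::real) ^ n = 2 ^ n * 2 ^ n"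
        by (simp flip: power_mult_distrib)
      ultimately show ?thesis
        by (simp add: a_def mult_ac)
    qed
    also have "4 ^ n * fact n / fact (2 * n) = Gamma (1 / 2) / Gamma (1 / 2 + real n)"
      using Gamma_nat_plus_half[of n] by (simp add: Gamma_one_half_real add_ac)
    finally show ?thesis
      by simp
  qed
  ultimately show ?thesis
    by (simp add: hyp_1F1_def d_def)
qed

text \<open>The kernel is an average of cosines over the Gaussian length, which bounds it by 1.
  Averaging also over the direction restores the full Gaussian vector, whose mean cosine is the
  Gaussian kernel.\<close>

lemma one_dim_counterpart_Gaussian:
  assumes "\<sigma> > 0"
  shows "one_dim_counterpart (\<lambda>x y :: 'a::euclidean_space. exp (- ((norm (x - y))\<^sup>2 / (2 * \<sigma>\<^sup>2))))
      (\<lambda>s t. hyp_1F1 (real DIM('a) / 2) (1 / 2) (- (\<bar>s - t\<bar>\<^sup>2) / (2 * \<sigma>\<^sup>2)))" (is "one_dim_counterpart _ ?k")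
    and "\<bar>hyp_1F1 (real DIM('a) / 2) (1 / 2) (- (\<bar>s - t\<bar>\<^sup>2) / (2 * \<sigma>\<^sup>2))\<bar> \<le> 1"
proof -
  interpret G: prob_space "std_gaussian :: 'a measure"
    by (rule prob_space_std_gaussian)
  have k: "?k s t = (\<integral>x. cos (norm x * ((s - t) / \<sigma>)) \<partial>(std_gaussian :: 'a measure))" for s t
    using hyp_1F1_eq_integral_cos[where 'a='a, of "(s - t) / \<sigma>"] by (simp add: power_divide mult.commute)
  have int: "integrable std_gaussian (\<lambda>x::'a. cos (g x))" if [measurable]: "g \<in> borel_measurable borel" for g :: "'a \<Rightarrow> real"
    by (intro G.integrable_const_bound[where B=1]) auto
  show "\<bar>?k s t\<bar> \<le> 1"
  proof -
    have "\<bar>?k s t\<bar> \<le> (\<integral>x. \<bar>cos (norm x * ((s - t) / \<sigma>))\<bar> \<partial>(std_gaussian :: 'a measure))"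
      unfolding k by (rule integral_abs_bound)
    also have "\<dots> \<le> (\<integral>x. 1 \<partial>(std_gaussian :: 'a measure))"
      by (intro integral_mono integrable_abs int) auto
    finally show ?thesis
      using G.prob_space by simp
  qed
  show "one_dim_counterpart (\<lambda>x y :: 'a. exp (- ((norm (x - y))\<^sup>2 / (2 * \<sigma>\<^sup>2)))) ?k"
    unfolding one_dim_counterpart_def
  proof (intro conjI allI)
    \<comment> \<open>Measurability is read off from the integral representation rather than from
      the series.\<close>
    show "(\<lambda>(s, t). ?k s t) \<in> borel_measurable (borel \<Otimes>\<^sub>M borel)"
      unfolding k by measurable
    fix x y :: 'a
    \<comment> \<open>Absorbing \<open>\<sigma>\<close> into \<open>z\<close> makes the exponent
      equal to \<open>- (norm z)\<^sup>2 / 2\<close>.\<close>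
    define z where "z = (x - y) /\<^sub>R \<sigma>"
    have norm_z: "norm z = norm (x - y) / \<sigma>"
      using assms by (simp add: z_def divide_inverse mult.commute)
    have eq: "?k (\<xi> \<bullet> x) (\<xi> \<bullet> y) = (\<integral>x. cos (norm x * (\<xi> \<bullet> z)) \<partial>(std_gaussian :: 'a measure))" for \<xi>
      unfolding k z_def by (simp add: inner_diff_right divide_inverse mult_ac)
    have cos_eq: "cos (norm v * (sgn v \<bullet> z)) = cos (v \<bullet> z)" for v :: 'a
      by (cases "v = 0") (simp_all add: sgn_div_norm flip: mult.assoc)
    note * = integral_std_gaussian_sgn_norm[of "\<lambda>\<xi> r. cos (r * (\<xi> \<bullet> z))", unfolded cos_eq]
    show "integrable sphere_uniform (\<lambda>\<xi>. ?k (\<xi> \<bullet> x) (\<xi> \<bullet> y))"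
      unfolding eq by (rule *(2)) (simp_all add: int)
    have "(\<integral>\<xi>. ?k (\<xi> \<bullet> x) (\<xi> \<bullet> y) \<partial>sphere_uniform) = (\<integral>v. cos (v \<bullet> z) \<partial>std_gaussian)"
      unfolding eq by (rule *(1)[symmetric]) (simp_all add: int)
    then show "exp (- ((norm (x - y))\<^sup>2 / (2 * \<sigma>\<^sup>2))) = (\<integral>\<xi>. ?k (\<xi> \<bullet> x) (\<xi> \<bullet> y) \<partial>sphere_uniform)"
      using norm_z by (simp add: integral_std_gaussian_cos power_divide mult.commute)
  qed
qed

text \<open>For a Gaussian \<open>X\<close>, independence splits the mean of
  \<open>\<bar>X \<bullet> z\<bar>\<close> into the mean length times the wanted spherical mean. The
  first two are known, and the quotient gives the third.\<close>

lemma sphere_uniform_abs_inner: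
  fixes z :: "'a::euclidean_space"
  shows "integrable sphere_uniform (\<lambda>\<xi>. \<bar>\<xi> \<bullet> z\<bar>)"
    and "(\<integral>\<xi>. \<bar>\<xi> \<bullet> z\<bar> \<partial>sphere_uniform) =
      Gamma (real DIM('a) / 2) / (sqrt pi * Gamma ((real DIM('a) + 1) / 2)) * norm z"
proof -
  interpret G: prob_space "std_gaussian :: 'a measure"
    by (rule prob_space_std_gaussian)
  interpret S: prob_space "sphere_uniform :: 'a measure"
    by (rule prob_space_sphere_uniform)
  \<comment> \<open>The mean length of a standard Gaussian vector.\<close>
  define R where "R = sqrt 2 * Gamma ((real DIM('a) + 1) / 2) / Gamma (real DIM('a) / 2)"
  have Gamma_nz: "Gamma (real DIM('a) / 2) \<noteq> 0" "Gamma ((real DIM('a) + 1) / 2) \<noteq> 0"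
    by (intro less_imp_neq[symmetric] Gamma_real_pos; simp)+
  have R: "has_bochner_integral std_gaussian (\<lambda>x::'a. norm x) R"
    using has_bochner_integral_std_gaussian_norm_power[where 'a='a, of 1] by (simp add: R_def)
  have [measurable]: "(\<lambda>\<xi>. \<bar>\<xi> \<bullet> z\<bar>) \<in> borel_measurable sphere_uniform"
    by (simp add: sphere_uniform_def)
  show "integrable sphere_uniform (\<lambda>\<xi>. \<bar>\<xi> \<bullet> z\<bar>)"
  proof (rule S.integrable_const_bound[where B="norm z"])
    have "norm \<bar>\<xi> \<bullet> z\<bar> \<le> norm z" if "\<xi> \<in> sphere 0 1" for \<xi>
      using Cauchy_Schwarz_ineq2[of \<xi> z] that by simp
    then show "AE \<xi> in sphere_uniform. norm \<bar>\<xi> \<bullet> z\<bar> \<le> norm z"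
      using AE_sphere_uniform by (auto elim: eventually_mono)
  qed simp
  have abs_eq: "norm v * \<bar>sgn v \<bullet> z\<bar> = \<bar>v \<bullet> z\<bar>" for v :: 'a
    by (cases "v = 0") (simp_all add: sgn_div_norm abs_mult)
  have "integrable std_gaussian (\<lambda>x. \<bar>x \<bullet> z\<bar>)"
  proof (rule Bochner_Integration.integrable_bound)
    show "integrable std_gaussian (\<lambda>x::'a. norm x * norm z)"
      using R by (auto simp: has_bochner_integral_iff)
    show "AE x in std_gaussian. norm \<bar>x \<bullet> z\<bar> \<le> norm (norm x * norm z)"
      by (simp add: Cauchy_Schwarz_ineq2)
  qed simp
  then have "sqrt (2 / pi) * norm z = (\<integral>\<xi>. (\<integral>x. norm x * \<bar>\<xi> \<bullet> z\<bar> \<partial>(std_gaussian :: 'a measure)) \<partial>sphere_uniform)"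
    using integral_std_gaussian_sgn_norm(1)[of "\<lambda>\<xi> r. r * \<bar>\<xi> \<bullet> z\<bar>", unfolded abs_eq]
    by (simp add: integral_std_gaussian_abs_inner)
  also have "\<dots> = R * (\<integral>\<xi>. \<bar>\<xi> \<bullet> z\<bar> \<partial>sphere_uniform)"
    using R by (simp add: has_bochner_integral_iff)
  finally show "(\<integral>\<xi>. \<bar>\<xi> \<bullet> z\<bar> \<partial>sphere_uniform) =
      Gamma (real DIM('a) / 2) / (sqrt pi * Gamma ((real DIM('a) + 1) / 2)) * norm z"
    using Gamma_nz by (simp add: R_def real_sqrt_divide field_simps)
qed

text \<open>The factor in the kernel is the reciprocal of the spherical mean of
  \<open>\<bar>\<xi> \<bullet> z\<bar>\<close> for a unit vector \<open>z\<close>.\<close>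

lemma one_dim_counterpart_neg_distance:
  "one_dim_counterpart (\<lambda>x y :: 'a::euclidean_space. - norm (x - y))
    (\<lambda>s t. - (sqrt pi * Gamma ((real DIM('a) + 1) / 2) / Gamma (real DIM('a) / 2)) * \<bar>s - t\<bar>)"
  unfolding one_dim_counterpart_def
proof (intro conjI allI)
  fix x y :: 'a
  have Gamma_nz: "Gamma (real DIM('a) / 2) \<noteq> 0" "Gamma ((real DIM('a) + 1) / 2) \<noteq> 0"
    by (intro less_imp_neq[symmetric] Gamma_real_pos; simp)+
  have eq: "\<bar>\<xi> \<bullet> x - \<xi> \<bullet> y\<bar> = \<bar>\<xi> \<bullet> (x - y)\<bar>" for \<xi>
    by (simp add: inner_diff_right)
  show "integrable sphere_uniform (\<lambda>\<xi>. - (sqrt pi * Gamma ((real DIM('a) + 1) / 2) / Gamma (real DIM('a) / 2)) * \<bar>\<xi> \<bullet> x - \<xi> \<bullet> y\<bar>)"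
    unfolding eq by (intro integrable_mult_right sphere_uniform_abs_inner)
  show "- norm (x - y) = (\<integral>\<xi>. - (sqrt pi * Gamma ((real DIM('a) + 1) / 2) / Gamma (real DIM('a) / 2)) * \<bar>\<xi> \<bullet> x - \<xi> \<bullet> y\<bar> \<partial>sphere_uniform)"
    unfolding eq using Gamma_nz
    by (subst Bochner_Integration.integral_mult_right) (simp_all add: sphere_uniform_abs_inner)
qed simp

section \<open>Error bounds for the sliced estimator and their growth rates\<close>

theorem theorem2p8:
  fixes M :: "'w measure"
    and \<xi> :: "nat \<Rightarrow> 'w \<Rightarrow> real ^ 'd"
    and P :: nat
  assumes "prob_space M"
    and "P \<ge> 1"
    and "prob_space.indep_vars M (\<lambda>_. borel) \<xi> {1..P}"
    and "\<And>p. p \<in> {1..P} \<Longrightarrow> distr M borel (\<xi> p) = sphere_uniform"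
  shows
    "(\<forall>(K :: real ^ 'd \<Rightarrow> real ^ 'd \<Rightarrow> real) k C.
       one_dim_counterpart K k \<longrightarrow> (\<forall>s t. \<bar>k s t\<bar> \<le> C) \<longrightarrow>
       (\<forall>x y. integrable M (\<lambda>\<omega>. \<bar>sliced_estimator k P (\<lambda>p. \<xi> p \<omega>) x y - K x y\<bar>) \<and>
              (LINT \<omega>|M. \<bar>sliced_estimator k P (\<lambda>p. \<xi> p \<omega>) x y - K x y\<bar>)
                \<le> sqrt (2 * pi) * C / sqrt (real P))) \<and>
     (\<forall>C::real. \<exists>A. \<forall>n\<ge>1::nat.
        \<bar>sqrt (2 * pi) * C / sqrt (real n)\<bar> \<le> A * (1 / sqrt (real n))) \<and>
     (\<forall>\<sigma>>0::real.
        let K = (\<lambda>x y :: real ^ 'd. exp (- ((norm (x - y))\<^sup>2 / (2 * \<sigma>\<^sup>2))));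
            k = (\<lambda>s t. hyp_1F1 (real CARD('d) / 2) (1 / 2) (- (\<bar>s - t\<bar>\<^sup>2) / (2 * \<sigma>\<^sup>2)))
        in one_dim_counterpart K k \<and> (\<forall>s t. \<bar>k s t\<bar> \<le> 1)) \<and>
     (let K = (\<lambda>x y :: real ^ 'd. - norm (x - y));
          k = (\<lambda>s t. - (sqrt pi * Gamma ((real CARD('d) + 1) / 2) / Gamma (real CARD('d) / 2))
                       * \<bar>s - t\<bar>)
      in one_dim_counterpart K k \<and>
         (\<forall>x y. integrable M (\<lambda>\<omega>. \<bar>sliced_estimator k P (\<lambda>p. \<xi> p \<omega>) x y - K x y\<bar>) \<and>
                (LINT \<omega>|M. \<bar>sliced_estimator k P (\<lambda>p. \<xi> p \<omega>) x y - K x y\<bar>)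
                  \<le> sqrt 8 * pi * Gamma ((real CARD('d) + 1) / 2) * norm (x - y)
                      / (Gamma (real CARD('d) / 2) * sqrt (real P)))) \<and>
     (\<exists>A. \<forall>d\<ge>1::nat. \<forall>n\<ge>1::nat. \<forall>r\<ge>0::real.
        \<bar>sqrt 8 * pi * Gamma ((real d + 1) / 2) * r / (Gamma (real d / 2) * sqrt (real n))\<bar>
          \<le> A * (sqrt (real d) * r / sqrt (real n)))"
proof (intro conjI)
  have P: "real P > 0"
    using \<open>P \<ge> 1\<close> by simp
  have "\<forall>p\<in>{1..P}. distr M borel (\<xi> p) = sphere_uniform"
    using assms(4) by blast
  note error = sliced_estimator_mean_error[OF assms(1-3) this]
  show "\<forall>(K :: real ^ 'd \<Rightarrow> real ^ 'd \<Rightarrow> real) k C.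
       one_dim_counterpart K k \<longrightarrow> (\<forall>s t. \<bar>k s t\<bar> \<le> C) \<longrightarrow>
       (\<forall>x y. integrable M (\<lambda>\<omega>. \<bar>sliced_estimator k P (\<lambda>p. \<xi> p \<omega>) x y - K x y\<bar>) \<and>
              (LINT \<omega>|M. \<bar>sliced_estimator k P (\<lambda>p. \<xi> p \<omega>) x y - K x y\<bar>)
                \<le> sqrt (2 * pi) * C / sqrt (real P))"
  proof (intro allI impI)
    fix K :: "real ^ 'd \<Rightarrow> real ^ 'd \<Rightarrow> real" and k C x y
    assume K: "one_dim_counterpart K k" and C: "\<forall>s t. \<bar>k s t\<bar> \<le> C"
    have "C \<ge> 0"
      using C[rule_format, of 0 0] by linarith
    \<comment> \<open>The variance argument already gives \<open>C / sqrt P\<close>; the stated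
      constant is larger, and nonnegativity of \<open>C\<close> makes the comparison valid.\<close>
    moreover have "sqrt (2 * pi) \<ge> 1"
      using pi_ge_two by simp
    ultimately have "C / sqrt (real P) \<le> sqrt (2 * pi) * C / sqrt (real P)"
      using P mult_right_mono[of 1 "sqrt (2 * pi)" C] by (intro divide_right_mono) auto
    with error[OF K, of x y C] C
    show "integrable M (\<lambda>\<omega>. \<bar>sliced_estimator k P (\<lambda>p. \<xi> p \<omega>) x y - K x y\<bar>) \<and>
          (LINT \<omega>|M. \<bar>sliced_estimator k P (\<lambda>p. \<xi> p \<omega>) x y - K x y\<bar>)
            \<le> sqrt (2 * pi) * C / sqrt (real P)"
      by simp
  qed
  show "\<forall>C::real. \<exists>A. \<forall>n\<ge>1::nat.
      \<bar>sqrt (2 * pi) * C / sqrt (real n)\<bar> \<le> A * (1 / sqrt (real n))"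
  proof
    fix C :: real
    show "\<exists>A. \<forall>n\<ge>1::nat. \<bar>sqrt (2 * pi) * C / sqrt (real n)\<bar> \<le> A * (1 / sqrt (real n))"
      \<comment> \<open>The absolute value appears because \<open>C\<close> ranges over all reals
        here, detached from any kernel.\<close>
      by (rule exI[of _ "sqrt (2 * pi) * \<bar>C\<bar>"]) (simp add: abs_mult)
  qed
  show "\<forall>\<sigma>>0::real.
        let K = (\<lambda>x y :: real ^ 'd. exp (- ((norm (x - y))\<^sup>2 / (2 * \<sigma>\<^sup>2))));
            k = (\<lambda>s t. hyp_1F1 (real CARD('d) / 2) (1 / 2) (- (\<bar>s - t\<bar>\<^sup>2) / (2 * \<sigma>\<^sup>2)))
        in one_dim_counterpart K k \<and> (\<forall>s t. \<bar>k s t\<bar> \<le> 1)"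
    using one_dim_counterpart_Gaussian[where 'a="real ^ 'd"] by (simp add: Let_def)
  let ?c = "sqrt pi * Gamma ((real CARD('d) + 1) / 2) / Gamma (real CARD('d) / 2)"
  have Gamma_pos: "Gamma ((real CARD('d) + 1) / 2) > 0" "Gamma (real CARD('d) / 2) > 0"
    by (intro Gamma_real_pos; simp)+
  have counterpart: "one_dim_counterpart (\<lambda>x y :: real ^ 'd. - norm (x - y)) (\<lambda>s t. - ?c * \<bar>s - t\<bar>)"
    using one_dim_counterpart_neg_distance[where 'a="real ^ 'd"] by simp
  show "let K = (\<lambda>x y :: real ^ 'd. - norm (x - y));
          k = (\<lambda>s t. - (sqrt pi * Gamma ((real CARD('d) + 1) / 2) / Gamma (real CARD('d) / 2))
                       * \<bar>s - t\<bar>)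
      in one_dim_counterpart K k \<and>
         (\<forall>x y. integrable M (\<lambda>\<omega>. \<bar>sliced_estimator k P (\<lambda>p. \<xi> p \<omega>) x y - K x y\<bar>) \<and>
                (LINT \<omega>|M. \<bar>sliced_estimator k P (\<lambda>p. \<xi> p \<omega>) x y - K x y\<bar>)
                  \<le> sqrt 8 * pi * Gamma ((real CARD('d) + 1) / 2) * norm (x - y)
                      / (Gamma (real CARD('d) / 2) * sqrt (real P)))"
    unfolding Let_def
  proof (intro conjI allI)
    show "one_dim_counterpart (\<lambda>x y :: real ^ 'd. - norm (x - y)) (\<lambda>s t. - ?c * \<bar>s - t\<bar>)"
      by (rule counterpart)
    fix x y :: "real ^ 'd"
    \<comment> \<open>Cauchy-Schwarz on unit vectors bounds the kernel along every direction;
      \<open>sphere_uniform\<close> is concentrated there, so the almost everywhere bound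
      follows.\<close>
    have "\<bar>- ?c * \<bar>v \<bullet> x - v \<bullet> y\<bar>\<bar> \<le> ?c * norm (x - y)" if "v \<in> sphere 0 1" for v
    proof -
      have "\<bar>v \<bullet> x - v \<bullet> y\<bar> \<le> norm (x - y)"
        using Cauchy_Schwarz_ineq2[of v "x - y"] that by (simp add: inner_diff_right)
      then have "?c * \<bar>v \<bullet> x - v \<bullet> y\<bar> \<le> ?c * norm (x - y)"
        using Gamma_pos by (intro mult_left_mono) (auto intro!: divide_nonneg_pos)
      then show ?thesis
        using Gamma_pos by (simp add: abs_mult)
    qed
    then have "AE v in sphere_uniform. \<bar>- ?c * \<bar>v \<bullet> x - v \<bullet> y\<bar>\<bar> \<le> ?c * norm (x - y)"
      using AE_sphere_uniform by (auto elim: eventually_mono)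
    note bound = error[OF counterpart this]
    show "integrable M (\<lambda>\<omega>. \<bar>sliced_estimator (\<lambda>s t. - ?c * \<bar>s - t\<bar>) P (\<lambda>p. \<xi> p \<omega>) x y - - norm (x - y)\<bar>)"
      by (rule bound)
    \<comment> \<open>The general error bound carries the factor \<open>sqrt pi\<close>, which is
      enlarged to the stated \<open>sqrt 8 * pi\<close>.\<close>
    have "sqrt pi \<le> pi"
      using pi_ge_two by (intro real_le_lsqrt) (auto simp: power2_eq_square)
    also have "pi \<le> sqrt 8 * pi"
      by simp
    finally have "sqrt pi * (Gamma ((real CARD('d) + 1) / 2) * norm (x - y) / (Gamma (real CARD('d) / 2) * sqrt (real P)))
        \<le> sqrt 8 * pi * (Gamma ((real CARD('d) + 1) / 2) * norm (x - y) / (Gamma (real CARD('d) / 2) * sqrt (real P)))"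
      using Gamma_pos P by (intro mult_right_mono) auto
    with bound(2) show "(LINT \<omega>|M. \<bar>sliced_estimator (\<lambda>s t. - ?c * \<bar>s - t\<bar>) P (\<lambda>p. \<xi> p \<omega>) x y - - norm (x - y)\<bar>)
        \<le> sqrt 8 * pi * Gamma ((real CARD('d) + 1) / 2) * norm (x - y)
                      / (Gamma (real CARD('d) / 2) * sqrt (real P))"
      by (simp add: mult_ac)
  qed
  show "\<exists>A. \<forall>d\<ge>1::nat. \<forall>n\<ge>1::nat. \<forall>r\<ge>0::real.
        \<bar>sqrt 8 * pi * Gamma ((real d + 1) / 2) * r / (Gamma (real d / 2) * sqrt (real n))\<bar>
          \<le> A * (sqrt (real d) * r / sqrt (real n))"
  \<comment> \<open>The witness is chosen before \<open>d\<close>, \<open>n\<close> and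
    \<open>r\<close>, hence absolute; all dependence on the dimension goes through
    \<open>Gamma_ratio_le\<close>.\<close>
  proof (intro exI[of _ "sqrt 8 * pi"] allI impI)
    fix d n :: nat and r :: real
    assume d: "d \<ge> 1" and n: "n \<ge> 1" and r: "r \<ge> 0"
    have Gamma_pos: "Gamma ((real d + 1) / 2) > 0" "Gamma (real d / 2) > 0"
      using d by (intro Gamma_real_pos; simp)+
    have "Gamma ((real d + 1) / 2) / Gamma (real d / 2) \<le> sqrt (real d)"
      using d by (intro Gamma_ratio_le) simp
    then have "sqrt 8 * pi * (r / sqrt (real n)) * (Gamma ((real d + 1) / 2) / Gamma (real d / 2))
        \<le> sqrt 8 * pi * (r / sqrt (real n)) * sqrt (real d)"
      using r by (intro mult_left_mono) auto
    then show "\<bar>sqrt 8 * pi * Gamma ((real d + 1) / 2) * r / (Gamma (real d / 2) * sqrt (real n))\<bar>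
        \<le> sqrt 8 * pi * (sqrt (real d) * r / sqrt (real n))"
      using Gamma_pos r by (simp add: abs_mult mult_ac)
  qed
qed

end
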